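(* For any $G\in\Omega(\bar q)$, $$0\le\mathcal V(G)\le\mathcal V(\bar G),$$ where $\bar G$ is the transport path from $\mathbf a$ to $\mathbf b$ routing everything through a single hub $x^*$ (defined in the context).
   Context: Notation: $\mathbb{R}_+^k$ and $\mathbb{R}_{++}^k$ are the vectors in $\mathbb{R}^k$ with all coordinates $\ge 0$, respectively $>0$. Economy. $X\subset\mathbb{R}^m$ is compact and convex. There are $k$ goods, good $i$ being supplied at a point $x_i\in X$, and $\ell$ consumers, consumer $j$ being located at $y_j\in X$ (all these points distinct). Consumer $j$ has a utility function $u_j:\mathbb{R}_+^k\to\mathbb{R}$ that is continuous, concave and increasing ($u_j(q')>u_j(q)$ whenever $q'_i>q_i$ for all $i$), a wealth $w_j>0$ and a price vector $p_j=(p_{1j},\dots,p_{kj})\in\mathbb{R}_{++}^k$. Fix for each $j$ a maximizer $\bar q_j=(\bar q_{1j},\dots,\bar q_{kj})$ of $u_j(q_j)$ over $\{q_j\in\mathbb{R}_+^k: p_j\cdot q_j\le w_j\}$, and let $\bar q=(\bar q_{ij})_{k\times\ell}$, normalized so that $\sum_{i,j}\bar q_{ij}=1$. Put $m_i=\sum_j\bar q_{ij}$, $n_j=\sum_i\bar q_{ij}$ (all positive), $\mathbf a=\sum_i m_i\delta_{x_i}$, $\mathbf b=\sum_j n_j\delta_{y_j}$. $\mathcal P(X\times X)$ denotes probability measures $q=\sum_{i,j}q_{ij}\delta_{(x_i,y_j)}$, identified with nonnegative $k\times\ell$ matrices of total sum 1; $q_j=(q_{1j},\dots,q_{kj})$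 is the $j$-th column. Transport paths. A transport path $G$ from $\mathbf a$ to $\mathbf b$ is a finite weighted directed graph with vertex set $V(G)\subset X$ containing all $x_i,y_j$, directed edges $e\in E(G)$ which are line segments from $e^-$ to $e^+$, and weights $w(e)>0$, such that for every vertex $v$, $\sum_{e^-=v}w(e)=\sum_{e^+=v}w(e)+c_v$, where $c_v=m_i$ if $v=x_i$, $c_v=-n_j$ if $v=y_j$, and $c_v=0$ otherwise. It is assumed that for each $(i,j)$ there is at most one directed curve $g_{ij}$ from $x_i$ to $y_j$ in $G$, i.e. at most one list of distinct vertices starting at $x_i$ and ending at $y_j$ whose consecutive members are joined by directed edges of $G$; $e\subseteq g_{ij}$ means that the edge $e$ lies on this curve. A matrix $q\in\mathcal P(X\times X)$ is compatible with $G$ if $q_{ij}=0$ whenever $g_{ij}$ does not exist and $\sum_{(i,j):e\subseteq g_{ij}}q_{ij}=w(e)$ for every $e\in E(G)$. $\Omega(\bar q)$ is the set of transport paths $G$ from $\mathbf a$ to $\mathbf b$ with which $\bar q$ is compatible. Exchange value. $S(q)=\sum_{j=1}^\ell\min\{p_j\cdot t_j: t_j\in\mathbb{R}_+^k,\ u_j(t_j)\ge u_j(q_j)\}$. For $G\in\Omega(\bar q)$, $\mathcal F_G$ is the set of $q\in\mathcal P(X\times X)$ compatible with $G$ with $u_j(q_j)\ge u_j(\bar q_j)$ for all $j$, and $\mathcal V(G)=\max_{q\in\mathcal F_G}S(q)-S(\bar q)$. The path $\bar G$. Fix $x^*\in X\setminus\{x_1,\dots,x_k,y_1,\dots,y_\ell\}$.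 $\bar G$ has vertices $x_1,\dots,x_k,y_1,\dots,y_\ell,x^*$, directed edges $[x_i,x^*]$ ($i=1,\dots,k$) with weight $m_i$ and $[x^*,y_j]$ ($j=1,\dots,\ell$) with weight $n_j$; its curve $g_{ij}$ is $[x_i,x^*]\cup[x^*,y_j]$. *)

theory Defs
  imports "HOL-Analysis.Analysis" "Graph_Theory.Graph_Theory"
begin

text \<open>
  The \<open>k\<close> goods are the elements of a finite type \<open>'k\<close> and the \<open>\<ell>\<close> consumers those of a finite
  type \<open>'l\<close>. A \<open>k \<times> \<ell>\<close> matrix \<open>q\<close> has type \<open>real^'l^'k\<close>, its entries are \<open>q $ i $ j\<close>, and
  consumer \<open>j\<close>'s bundle is the library's \<open>column j q\<close>.
\<close>

definition orthant :: "(real^'k) set" where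
  "orthant = {t. \<forall>i. 0 \<le> t $ i}"

definition increasing_utility :: "(real^'k \<Rightarrow> real) \<Rightarrow> bool" where
  "increasing_utility v \<longleftrightarrow>
     (\<forall>t\<in>orthant. \<forall>t'\<in>orthant. (\<forall>i. t $ i < t' $ i) \<longrightarrow> v t < v t')"

definition budget_set :: "real^'k \<Rightarrow> real \<Rightarrow> (real^'k) set" where
  "budget_set pr w = {t \<in> orthant. pr \<bullet> t \<le> w}"

definition total_supply :: "real^'l^'k \<Rightarrow> 'k \<Rightarrow> real" where
  "total_supply q i = (\<Sum>j\<in>UNIV. q $ i $ j)"

definition total_demand :: "real^'l^'k \<Rightarrow> 'l \<Rightarrow> real" where
  "total_demand q j = (\<Sum>i\<in>UNIV. q $ i $ j)"

text \<open>The measures \<open>\<Sum>\<^sub>i\<^sub>j q\<^sub>i\<^sub>j \<delta>(x\<^sub>i, y\<^sub>j)\<close> in \<open>P(X \<times> X)\<close>, as matrices.\<close>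

definition prob_matrices :: "(real^'l^'k) set" where
  "prob_matrices =
     {q. (\<forall>i j. 0 \<le> q $ i $ j) \<and> (\<Sum>i\<in>UNIV. \<Sum>j\<in>UNIV. q $ i $ j) = 1}"

text \<open>
  A directed segment is determined by its endpoints, so an edge \<open>e\<close> is the pair \<open>(e\<^sup>-, e\<^sup>+)\<close>.
  Only the values of \<open>weight\<close> on edges matter.
\<close>

record 'a weighted_net =
  net :: "'a pair_pre_digraph"
  weight :: "'a \<times> 'a \<Rightarrow> real"

definition curves :: "'a weighted_net \<Rightarrow> 'a \<Rightarrow> 'a \<Rightarrow> 'a vwalk set" where
  "curves G a b = {c. vpath c (with_proj (net G)) \<and> hd c = a \<and> last c = b}"

definition inflow :: "'a weighted_net \<Rightarrow> 'a \<Rightarrow> real" where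
  "inflow G v = (\<Sum>e\<in>in_arcs (with_proj (net G)) v. weight G e)"

definition outflow :: "'a weighted_net \<Rightarrow> 'a \<Rightarrow> real" where
  "outflow G v = (\<Sum>e\<in>out_arcs (with_proj (net G)) v. weight G e)"

text \<open>
  Transport paths from \<open>\<Sum>\<^sub>i m\<^sub>i \<delta>(x\<^sub>i)\<close> to \<open>\<Sum>\<^sub>j n\<^sub>j \<delta>(y\<^sub>j)\<close>, including the standing assumption that
  there is at most one directed curve from each \<open>x\<^sub>i\<close> to each \<open>y\<^sub>j\<close>.
\<close>

definition transport_path ::
  "(real^'m) set \<Rightarrow> ('k::finite \<Rightarrow> real^'m) \<Rightarrow> ('l::finite \<Rightarrow> real^'m) \<Rightarrow>
   ('k \<Rightarrow> real) \<Rightarrow> ('l \<Rightarrow> real) \<Rightarrow> (real^'m) weighted_net \<Rightarrow> bool" where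
  "transport_path X x y m n G \<longleftrightarrow>
     pair_fin_digraph (net G) \<and>
     pverts (net G) \<subseteq> X \<and>
     range x \<union> range y \<subseteq> pverts (net G) \<and>
     (\<forall>e\<in>parcs (net G). 0 < weight G e) \<and>
     (\<forall>i. outflow G (x i) = inflow G (x i) + m i) \<and>
     (\<forall>j. outflow G (y j) = inflow G (y j) - n j) \<and>
     (\<forall>v \<in> pverts (net G) - (range x \<union> range y). outflow G v = inflow G v) \<and>
     (\<forall>i j. \<forall>c\<in>curves G (x i) (y j). \<forall>c'\<in>curves G (x i) (y j). c = c')"

text \<open>
  Where \<open>g\<^sub>i\<^sub>j\<close> exists, it is the only element of \<open>curves G (x i) (y j)\<close>.
\<close>

definition compatible ::
  "('k \<Rightarrow> 'a) \<Rightarrow> ('l \<Rightarrow> 'a) \<Rightarrow> 'a weighted_net \<Rightarrow> real^'l^'k \<Rightarrow> bool" where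
  "compatible x y G q \<longleftrightarrow>
     (\<forall>i j. curves G (x i) (y j) = {} \<longrightarrow> q $ i $ j = 0) \<and>
     (\<forall>e\<in>parcs (net G).
        (\<Sum>(i, j) \<in> {(i, j). \<exists>c\<in>curves G (x i) (y j). e \<in> set (vwalk_arcs c)}. q $ i $ j)
          = weight G e)"

definition Omega ::
  "(real^'m) set \<Rightarrow> ('k::finite \<Rightarrow> real^'m) \<Rightarrow> ('l::finite \<Rightarrow> real^'m) \<Rightarrow> real^'l^'k \<Rightarrow>
   (real^'m) weighted_net set" where
  "Omega X x y qbar =
     {G. transport_path X x y (total_supply qbar) (total_demand qbar) G \<and> compatible x y G qbar}"

text \<open>
  The minimum and the maximum below are rendered by \<open>LEAST\<close> and \<open>GREATEST\<close>: unlike \<open>Inf\<close> and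
  \<open>Sup\<close>, these are determined only if the extremum is attained.
\<close>

definition S_cost :: "('l \<Rightarrow> real^'k \<Rightarrow> real) \<Rightarrow> ('l \<Rightarrow> real^'k) \<Rightarrow> real^'l^'k \<Rightarrow> real" where
  "S_cost u p q =
     (\<Sum>j\<in>UNIV. LEAST c. \<exists>t\<in>orthant. u j (column j q) \<le> u j t \<and> c = p j \<bullet> t)"

definition feasible ::
  "('l \<Rightarrow> real^'k \<Rightarrow> real) \<Rightarrow> ('k \<Rightarrow> 'a) \<Rightarrow> ('l \<Rightarrow> 'a) \<Rightarrow> real^'l^'k \<Rightarrow>
   'a weighted_net \<Rightarrow> (real^'l^'k) set" where
  "feasible u x y qbar G =
     {q \<in> prob_matrices. compatible x y G q \<and> (\<forall>j. u j (column j qbar) \<le> u j (column j q))}"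

definition exchange_value ::
  "('l \<Rightarrow> real^'k \<Rightarrow> real) \<Rightarrow> ('l \<Rightarrow> real^'k) \<Rightarrow> ('k \<Rightarrow> 'a) \<Rightarrow> ('l \<Rightarrow> 'a) \<Rightarrow> real^'l^'k \<Rightarrow>
   'a weighted_net \<Rightarrow> real" where
  "exchange_value u p x y qbar G =
     (GREATEST s. \<exists>q\<in>feasible u x y qbar G. s = S_cost u p q) - S_cost u p qbar"

text \<open>
  The path through the single hub \<open>xs\<close>. The inverses give the intended weights \<open>m\<^sub>i\<close> on
  \<open>(x\<^sub>i, xs)\<close> and \<open>n\<^sub>j\<close> on \<open>(xs, y\<^sub>j)\<close> when the \<open>x\<^sub>i\<close>, \<open>y\<^sub>j\<close> and \<open>xs\<close> are distinct.
\<close>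

definition hub_path ::
  "('k \<Rightarrow> 'a) \<Rightarrow> ('l \<Rightarrow> 'a) \<Rightarrow> ('k \<Rightarrow> real) \<Rightarrow> ('l \<Rightarrow> real) \<Rightarrow> 'a \<Rightarrow> 'a weighted_net" where
  "hub_path x y m n xs =
     \<lparr> net = \<lparr> pverts = range x \<union> range y \<union> {xs},
              parcs = range (\<lambda>i. (x i, xs)) \<union> range (\<lambda>j. (xs, y j)) \<rparr>,
       weight = (\<lambda>(a, b). if b = xs then m (inv x a) else n (inv y b)) \<rparr>"

end

theory Submission
  imports Defs
begin

text \<open>
  A matrix compatible with \<open>G\<close> expresses the edge weights as superposed curves, and along a curve
  the differences of a vertex function telescope. Testing with the indicator of one \<open>x\<^sub>i\<close> or \<open>y\<^sub>j\<close>
  shows that \<open>G\<close> determines the row and column sums of every compatible matrix. Compatibility with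
  the hub path says exactly that these sums are \<open>m\<^sub>i\<close> and \<open>n\<^sub>j\<close>, hence \<open>F\<^sub>G \<subseteq> F\<^sub>h\<^sub>u\<^sub>b\<close>. Both maxima
  exist because \<open>S\<close> is upper semicontinuous on compact sets, and \<open>qbar \<in> F\<^sub>G\<close> gives the lower bound.
\<close>

section \<open>Row and column sums of compatible matrices\<close>

lemma vwalk_arcs_subset: "set (vwalk_arcs c) \<subseteq> set c \<times> set c"
  by (induction c rule: vwalk_arcs.induct) auto

text \<open>Distinctness of the vertices prevents an arc from occurring twice, so summing over the
  set of arcs counts each step of the walk exactly once.\<close>

lemma sum_vwalk_arcs_telescope:
  fixes f :: "'a \<Rightarrow> 'b::ab_group_add"
  assumes "distinct c" "c \<noteq> []"
  shows "(\<Sum>e\<in>set (vwalk_arcs c). f (fst e) - f (snd e)) = f (hd c) - f (last c)"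
  using assms
proof (induction c rule: vwalk_arcs.induct)
  case (3 a b c)
  have "(a, b) \<notin> set (vwalk_arcs (b # c))"
    using vwalk_arcs_subset[of "b # c"] 3 by auto
  with 3 show ?case by simp
qed auto

text \<open>Summation by parts: insert the compatibility equation for each weight, interchange the
  sums and telescope along each curve. The left side depends on \<open>G\<close> and
  \<open>f\<close> only, which makes the identity a source of invariants of
  \<open>q\<close>.\<close>

lemma compatible_divergence:
  fixes q :: "real^'l^'k" and f :: "'a \<Rightarrow> real"
  assumes fin: "finite (parcs (net G))"
    and uniq: "\<forall>i j. \<forall>c\<in>curves G (x i) (y j). \<forall>c'\<in>curves G (x i) (y j). c = c'"
    and comp: "compatible x y G q"
  shows "(\<Sum>e\<in>parcs (net G). weight G e * (f (fst e) - f (snd e)))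
    = (\<Sum>i\<in>UNIV. \<Sum>j\<in>UNIV. q $ i $ j * (f (x i) - f (y j)))"
proof -
  \<comment> \<open>The arcs of the curve from \<open>x i\<close> to \<open>y j\<close>, or the
    empty set if there is no curve.\<close>
  define A where "A i j = {e. \<exists>c\<in>curves G (x i) (y j). e \<in> set (vwalk_arcs c)}" for i j
  define d where "d e = f (fst e) - f (snd e)" for e
  have curve: "q $ i $ j * (\<Sum>e\<in>parcs (net G). if e \<in> A i j then d e else 0)
      = q $ i $ j * (f (x i) - f (y j))" for i j
  proof (cases "curves G (x i) (y j) = {}")
    case True
    \<comment> \<open>Without a curve the factor \<open>q $ i $ j\<close> is 0, although
      \<open>f (x i) - f (y j)\<close> need not be.\<close>
    then show ?thesis using comp by (auto simp: compatible_def)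
  next
    case False
    then obtain c where c: "c \<in> curves G (x i) (y j)" by blast
    \<comment> \<open>Uniqueness makes \<open>A i j\<close> the arc set of a single walk; a union of
      several curves would not telescope.\<close>
    have "c' = c" if "c' \<in> curves G (x i) (y j)" for c'
      by (rule uniq[THEN spec, THEN spec, THEN bspec, OF that, THEN bspec, OF c])
    with c have "curves G (x i) (y j) = {c}" by blast
    then have A: "A i j = set (vwalk_arcs c)" by (simp add: A_def)
    have c': "distinct c" "c \<noteq> []" "hd c = x i" "last c = y j" "set (vwalk_arcs c) \<subseteq> parcs (net G)"
      using c by (auto simp: curves_def vpath_def vwalk_def)
    have "(\<Sum>e\<in>parcs (net G). if e \<in> A i j then d e else 0) = (\<Sum>e\<in>set (vwalk_arcs c). d e)"
      unfolding A using c'(5) fin by (intro sum.mono_neutral_cong_right) auto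
    also have "\<dots> = f (x i) - f (y j)"
      using sum_vwalk_arcs_telescope[OF c'(1,2), of f] c'(3,4) by (simp add: d_def)
    finally show ?thesis by simp
  qed
  have weight: "weight G e = (\<Sum>i\<in>UNIV. \<Sum>j\<in>UNIV. if e \<in> A i j then q $ i $ j else 0)"
    if "e \<in> parcs (net G)" for e
  proof -
    have "weight G e = (\<Sum>(i, j) \<in> {(i, j). e \<in> A i j}. q $ i $ j)"
      using comp that by (simp add: compatible_def A_def)
    also have "\<dots> = (\<Sum>(i, j)\<in>UNIV. if e \<in> A i j then q $ i $ j else 0)"
      by (intro sum.mono_neutral_cong_left) (auto split: if_splits)
    also have "\<dots> = (\<Sum>i\<in>UNIV. \<Sum>j\<in>UNIV. if e \<in> A i j then q $ i $ j else 0)"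
      by (simp add: sum.cartesian_product)
    finally show ?thesis .
  qed
  have "(\<Sum>e\<in>parcs (net G). weight G e * d e)
      = (\<Sum>e\<in>parcs (net G). \<Sum>i\<in>UNIV. \<Sum>j\<in>UNIV. q $ i $ j * (if e \<in> A i j then d e else 0))"
    by (intro sum.cong refl) (auto simp: weight sum_distrib_right intro!: sum.cong)
  also have "\<dots> = (\<Sum>i\<in>UNIV. \<Sum>e\<in>parcs (net G). \<Sum>j\<in>UNIV.
      q $ i $ j * (if e \<in> A i j then d e else 0))"
    by (rule sum.swap)
  also have "\<dots> = (\<Sum>i\<in>UNIV. \<Sum>j\<in>UNIV. \<Sum>e\<in>parcs (net G).
      q $ i $ j * (if e \<in> A i j then d e else 0))"
    by (intro sum.cong sum.swap refl)
  also have "\<dots> = (\<Sum>i\<in>UNIV. \<Sum>j\<in>UNIV. q $ i $ j * (f (x i) - f (y j)))"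
    by (simp only: sum_distrib_left[symmetric] curve)
  finally show ?thesis by (simp add: d_def)
qed

text \<open>Both matrices satisfy the divergence identity with the same left side, for every
  \<open>f\<close>; an indicator of one source or one sink isolates one row or column.\<close>

lemma compatible_same_marginals:
  fixes q r :: "real^'l^'k"
  assumes fin: "finite (parcs (net G))"
    and uniq: "\<forall>i j. \<forall>c\<in>curves G (x i) (y j). \<forall>c'\<in>curves G (x i) (y j). c = c'"
    and xy: "inj x" "inj y" "range x \<inter> range y = {}"
    and comp: "compatible x y G q" "compatible x y G r"
  shows "total_supply q = total_supply r" and "total_demand q = total_demand r"
proof -
  have ne: "x i \<noteq> y j" "y j \<noteq> x i" for i j
    using xy(3) by (metis disjoint_iff rangeI)+
  have eq: "(\<Sum>i\<in>UNIV. \<Sum>j\<in>UNIV. q $ i $ j * (f (x i) - f (y j)))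
      = (\<Sum>i\<in>UNIV. \<Sum>j\<in>UNIV. r $ i $ j * (f (x i) - f (y j)))" for f
    by (rule trans[OF compatible_divergence[OF fin uniq comp(1), symmetric]
          compatible_divergence[OF fin uniq comp(2)]])
  \<comment> \<open>For \<open>f\<close> the indicator of \<open>x i\<close>, the difference is 1 in
    row \<open>i\<close> and 0 in all others, as no \<open>y j\<close> equals
    \<open>x i\<close>.\<close>
  have sup: "total_supply s i
      = (\<Sum>i'\<in>UNIV. \<Sum>j\<in>UNIV. s $ i' $ j * (of_bool (x i' = x i) - of_bool (y j = x i)))"
    for s :: "real^'l^'k" and i
  proof -
    have "total_supply s i = (\<Sum>i'\<in>UNIV. if i' = i then \<Sum>j\<in>UNIV. s $ i' $ j else 0)"
      by (simp add: total_supply_def)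
    also have "\<dots> = (\<Sum>i'\<in>UNIV. \<Sum>j\<in>UNIV. s $ i' $ j * (of_bool (x i' = x i) - of_bool (y j = x i)))"
      using xy(1) ne by (intro sum.cong) (auto simp: inj_eq)
    finally show ?thesis .
  qed
  \<comment> \<open>The sign is negative because \<open>y j\<close> is where curves end.\<close>
  have dem: "- total_demand s j
      = (\<Sum>i\<in>UNIV. \<Sum>j'\<in>UNIV. s $ i $ j' * (of_bool (x i = y j) - of_bool (y j' = y j)))"
    for s :: "real^'l^'k" and j
    using xy(2) ne
    by (simp add: total_demand_def inj_eq of_bool_def sum_negf if_distrib cong: if_cong)
  show "total_supply q = total_supply r"
    unfolding fun_eq_iff sup using eq[of "\<lambda>v. of_bool (v = x _)"] by blast
  have "- total_demand q j = - total_demand r j" for j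
    unfolding dem by (rule eq)
  then show "total_demand q = total_demand r" by auto
qed

section \<open>Curves and compatible matrices of the hub path\<close>

text \<open>Every move is forced: the only arc out of \<open>x i\<close> leads to the hub, arcs out
  of the hub lead to sinks, and no arc leaves a sink.\<close>

lemma curves_hub_path:
  assumes "range x \<inter> range y = {}" and "xs \<notin> range x \<union> range y"
  shows "curves (hub_path x y m n xs) (x i) (y j) = {[x i, xs, y j]}"
proof (intro equalityI subsetI)
  have ne: "x i \<noteq> y j" "y j \<noteq> x i" "x i \<noteq> xs" "y j \<noteq> xs" "xs \<noteq> x i" "xs \<noteq> y j" for i j
    using assms by blast+
  fix c assume "c \<in> curves (hub_path x y m n xs) (x i) (y j)"
  then have c: "set (vwalk_arcs c) \<subseteq> range (\<lambda>i. (x i, xs)) \<union> range (\<lambda>j. (xs, y j))"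
    "c \<noteq> []" "hd c = x i" "last c = y j"
    by (auto simp: curves_def hub_path_def vpath_def vwalk_def)
  then obtain c1 where c1: "c = x i # c1" by (cases c) auto
  with c ne obtain b c2 where c2: "c1 = b # c2" by (cases c1) auto
  with c(1) c1 have "(x i, b) \<in> range (\<lambda>i. (x i, xs)) \<union> range (\<lambda>j. (xs, y j))" by simp
  with ne have b: "b = xs" by blast
  with c c1 c2 ne obtain b' c3 where c3: "c2 = b' # c3" by (cases c2) auto
  with c(1) c1 c2 b have "(xs, b') \<in> range (\<lambda>i. (x i, xs)) \<union> range (\<lambda>j. (xs, y j))" by simp
  with ne obtain j' where "b' = y j'" by blast
  \<comment> \<open>A further vertex would require an arc out of the sink
    \<open>y j'\<close>.\<close>
  moreover have "c3 = []"
  proof (cases c3)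
    case (Cons d c4)
    with c(1) c1 c2 c3 have "(b', d) \<in> range (\<lambda>i. (x i, xs)) \<union> range (\<lambda>j. (xs, y j))" by simp
    with ne \<open>b' = y j'\<close> show ?thesis by blast
  qed simp
  ultimately show "c \<in> {[x i, xs, y j]}"
    using c c1 c2 c3 b by simp
next
  fix c assume "c \<in> {[x i, xs, y j]}"
  moreover have "x i \<noteq> y j" using assms by blast
  ultimately show "c \<in> curves (hub_path x y m n xs) (x i) (y j)"
    using assms by (auto simp: curves_def hub_path_def vpath_def vwalk_def)
qed

text \<open>The arc from \<open>x i\<close> to the hub lies on exactly the curves starting at
  \<open>x i\<close>, so its equation is a row sum; likewise the arcs into sinks give column sums.
  The weights come from \<open>q\<close> itself and are later exchanged for those of
  \<open>qbar\<close>.\<close>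

lemma compatible_hub_path:
  fixes q :: "real^'l^'k"
  assumes xy: "inj x" "inj y" "range x \<inter> range y = {}" and xs: "xs \<notin> range x \<union> range y"
  shows "compatible x y (hub_path x y (total_supply q) (total_demand q) xs) q"
proof -
  let ?H = "hub_path x y (total_supply q) (total_demand q) xs"
  have ne: "x i \<noteq> xs" "y j \<noteq> xs" "xs \<noteq> x i" "xs \<noteq> y j" for i j
    using xs by blast+
  have "(\<Sum>(i', j) \<in> {(i', j). \<exists>c\<in>curves ?H (x i') (y j). (x i, xs) \<in> set (vwalk_arcs c)}. q $ i' $ j)
      = weight ?H (x i, xs)" for i
  proof -
    have "{(i', j). \<exists>c\<in>curves ?H (x i') (y j). (x i, xs) \<in> set (vwalk_arcs c)} = {i} \<times> UNIV"
      using xy ne by (auto simp: curves_hub_path[OF xy(3) xs] inj_eq)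
    then show ?thesis
      using xy by (simp add: sum.cartesian_product[symmetric] hub_path_def total_supply_def)
  qed
  moreover
  have "(\<Sum>(i, j') \<in> {(i, j'). \<exists>c\<in>curves ?H (x i) (y j'). (xs, y j) \<in> set (vwalk_arcs c)}. q $ i $ j')
      = weight ?H (xs, y j)" for j
  proof -
    have "{(i, j'). \<exists>c\<in>curves ?H (x i) (y j'). (xs, y j) \<in> set (vwalk_arcs c)} = UNIV \<times> {j}"
      using xy ne by (auto simp: curves_hub_path[OF xy(3) xs] inj_eq)
    then show ?thesis
      using xy ne by (simp add: sum.cartesian_product[symmetric] hub_path_def total_demand_def)
  qed
  moreover have "parcs (net ?H) = range (\<lambda>i. (x i, xs)) \<union> range (\<lambda>j. (xs, y j))"
    by (simp add: hub_path_def)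
  ultimately show ?thesis
    unfolding compatible_def by (auto simp: curves_hub_path[OF xy(3) xs])
qed

section \<open>Existence of the maxima\<close>

text \<open>Without a maximum every \<open>a\<close> is beaten by some \<open>b a\<close>, and
  semicontinuity keeps \<open>f\<close> below \<open>f (b a)\<close> on an open set around
  \<open>a\<close>. In a finite subcover the largest of these bounds is itself the value of
  \<open>f\<close> at a point of \<open>K\<close>, so another bound exceeds it.\<close>

lemma usc_attains_sup:
  fixes f :: "'a::topological_space \<Rightarrow> real"
  assumes K: "compact K" "K \<noteq> {}"
    and usc: "\<And>a c. a \<in> K \<Longrightarrow> f a < c \<Longrightarrow> \<forall>\<^sub>F z in at a within K. f z < c"
  shows "\<exists>a\<in>K. \<forall>z\<in>K. f z \<le> f a"
proof (rule ccontr)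
  assume "\<not> ?thesis"
  then obtain b where b: "\<And>a. a \<in> K \<Longrightarrow> b a \<in> K \<and> f a < f (b a)"
    by (metis not_le)
  have "\<exists>T. open T \<and> a \<in> T \<and> (\<forall>z\<in>T \<inter> K. f z < f (b a))" if "a \<in> K" for a
  proof -
    have "\<forall>\<^sub>F z in at a within K. f z < f (b a)"
      using usc b that by blast
    then obtain T where "open T" "a \<in> T" "\<forall>z\<in>T. z \<noteq> a \<longrightarrow> z \<in> K \<longrightarrow> f z < f (b a)"
      unfolding eventually_at_topological by blast
    \<comment> \<open>The filter omits the point \<open>a\<close>, where the bound is the choice of
      \<open>b a\<close>.\<close>
    with b[OF that] show ?thesis by (intro exI[of _ T]) auto
  qed
  then obtain T where T: "\<And>a. a \<in> K \<Longrightarrow> open (T a)" "\<And>a. a \<in> K \<Longrightarrow> a \<in> T a"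
    "\<And>a z. a \<in> K \<Longrightarrow> z \<in> T a \<Longrightarrow> z \<in> K \<Longrightarrow> f z < f (b a)"
    by (metis IntI)
  obtain D where D: "D \<subseteq> K" "finite D" "K \<subseteq> (\<Union>a\<in>D. T a)"
    using compactE_image[OF K(1), of K T] T by blast
  with K(2) have "D \<noteq> {}" by auto
  with D(2) obtain a where a: "a \<in> D" "\<And>a'. a' \<in> D \<Longrightarrow> f (b a') \<le> f (b a)"
    using obtains_MAX[of D "\<lambda>a. f (b a)"] by (metis Max_ge finite_imageI imageI)
  with b D obtain a' where "a' \<in> D" "b a \<in> T a'" by blast
  with T(3)[of a' "b a"] D(1) b a show False by fastforce
qed

section \<open>Budget sets and cheapest bundles of one consumer\<close>

lemma closed_orthant: "closed (orthant :: (real^'k) set)"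
proof -
  have "(orthant :: (real^'k) set) = (\<Inter>i. {t. 0 \<le> t $ i})"
    by (auto simp: orthant_def)
  also have "closed \<dots>"
    by (intro closed_INT ballI closed_Collect_le continuous_intros)
  finally show ?thesis .
qed

lemma compact_budget_set:
  fixes pr :: "real^'k"
  assumes "\<And>i. 0 < pr $ i"
  shows "compact (budget_set pr w)"
proof -
  have "t $ i \<le> w / pr $ i" if "t \<in> budget_set pr w" for t i
  proof -
    have "pr $ i * t $ i \<le> pr \<bullet> t"
      unfolding inner_vec_def inner_real_def
      using that assms by (intro member_le_sum) (auto simp: budget_set_def orthant_def less_imp_le)
    also have "\<dots> \<le> w" using that by (simp add: budget_set_def)
    finally show ?thesis using assms[of i] by (simp add: field_simps)
  qed
  then have "budget_set pr w \<subseteq> cbox 0 (\<chi> i. w / pr $ i)"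
    by (auto simp: mem_box_cart budget_set_def orthant_def)
  then have "bounded (budget_set pr w)"
    using bounded_cbox bounded_subset by blast
  moreover have "budget_set pr w = orthant \<inter> {t. pr \<bullet> t \<le> w}"
    by (auto simp: budget_set_def)
  then have "closed (budget_set pr w)"
    by (auto intro!: closed_Int closed_orthant closed_Collect_le continuous_intros)
  ultimately show ?thesis by (simp add: compact_eq_bounded_closed)
qed

text \<open>The expenditure function of consumer theory; \<open>S_cost\<close> is a sum of its
  values.\<close>

definition expenditure :: "(real^'k \<Rightarrow> real) \<Rightarrow> real^'k \<Rightarrow> real \<Rightarrow> real" where
  "expenditure v pr s = (LEAST c. \<exists>t\<in>orthant. s \<le> v t \<and> c = pr \<bullet> t)"

text \<open>The bundle \<open>z\<close> reaches its own utility level, so bundles costing more than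
  \<open>z\<close> may be discarded, and a compact set of candidates remains.\<close>

lemma expenditure_attained:
  fixes pr z :: "real^'k"
  assumes cont: "continuous_on orthant v" and pr: "\<And>i. 0 < pr $ i" and z: "z \<in> orthant"
  obtains t where "t \<in> orthant" "v z \<le> v t" "expenditure v pr (v z) = pr \<bullet> t"
    "\<And>t'. t' \<in> orthant \<Longrightarrow> v z \<le> v t' \<Longrightarrow> pr \<bullet> t \<le> pr \<bullet> t'"
proof -
  define K where "K = {t \<in> budget_set pr (pr \<bullet> z). v z \<le> v t}"
  have "continuous_on (budget_set pr (pr \<bullet> z)) v"
    by (rule continuous_on_subset[OF cont]) (auto simp: budget_set_def)
  then have "closed (budget_set pr (pr \<bullet> z) \<inter> v -` {v z..})"
    by (intro continuous_closed_preimage compact_imp_closed[OF compact_budget_set] pr) auto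
  then have "compact (budget_set pr (pr \<bullet> z) \<inter> (budget_set pr (pr \<bullet> z) \<inter> v -` {v z..}))"
    by (intro compact_Int_closed compact_budget_set pr)
  then have "compact K"
    by (rule back_subst[of compact]) (auto simp: K_def)
  moreover have "z \<in> K" using z by (auto simp: K_def budget_set_def)
  ultimately obtain t where t: "t \<in> K" "\<And>t'. t' \<in> K \<Longrightarrow> pr \<bullet> t \<le> pr \<bullet> t'"
    using continuous_attains_inf[of K "\<lambda>t. pr \<bullet> t"] by (fastforce intro!: continuous_intros)
  have min: "pr \<bullet> t \<le> pr \<bullet> t'" if "t' \<in> orthant" "v z \<le> v t'" for t'
  proof (cases "pr \<bullet> t' \<le> pr \<bullet> z")
    case True
    with that show ?thesis by (intro t) (auto simp: K_def budget_set_def)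
  next
    case False
    with t(2)[OF \<open>z \<in> K\<close>] show ?thesis by simp
  qed
  have t': "t \<in> orthant" "v z \<le> v t" using t(1) by (auto simp: K_def budget_set_def)
  have "expenditure v pr (v z) = pr \<bullet> t"
    unfolding expenditure_def by (rule Least_equality) (use t' min in auto)
  with t' min that show ?thesis by blast
qed

text \<open>
  A slight increase of all coordinates of a cheapest bundle strictly raises its utility, so it stays
  admissible, at almost the same cost, for all nearby utility levels.
\<close>

lemma expenditure_usc:
  fixes pr z0 :: "real^'k"
  assumes cont: "continuous_on orthant v" and incr: "increasing_utility v"
    and pr: "\<And>i. 0 < pr $ i" and z0: "z0 \<in> orthant" and eps: "0 < \<epsilon>"
  shows "\<forall>\<^sub>F z in at z0 within orthant. expenditure v pr (v z) < expenditure v pr (v z0) + \<epsilon>"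
proof -
  obtain t where t: "t \<in> orthant" "v z0 \<le> v t" "expenditure v pr (v z0) = pr \<bullet> t"
    using expenditure_attained[OF cont pr z0] by metis
  define P where "P = (\<Sum>i\<in>UNIV. pr $ i)"
  have P: "0 < P" unfolding P_def using pr by (intro sum_pos) auto
  \<comment> \<open>Raising all coordinates by \<open>\<delta>\<close> costs
    \<open>P * \<delta>\<close>, that is \<open>\<epsilon> / 2\<close>.\<close>
  define \<delta> where "\<delta> = \<epsilon> / (2 * P)"
  have \<delta>: "0 < \<delta>" using P eps by (simp add: \<delta>_def)
  define t1 where "t1 = (\<chi> i. t $ i + \<delta>)"
  have t1: "t1 \<in> orthant" "v t < v t1"
    using t(1) \<delta> incr by (auto simp: t1_def orthant_def increasing_utility_def add_nonneg_nonneg)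
  have "pr \<bullet> t1 = pr \<bullet> t + P * \<delta>"
    by (simp add: t1_def inner_vec_def P_def distrib_left sum.distrib sum_distrib_right)
  then have cost: "pr \<bullet> t1 < pr \<bullet> t + \<epsilon>"
    using P eps by (simp add: \<delta>_def)
  have "(v \<longlongrightarrow> v z0) (at z0 within orthant)"
    using cont z0 by (simp add: continuous_on_def)
  then have "\<forall>\<^sub>F z in at z0 within orthant. v z < v t1"
    using t(2) t1(2) by (auto elim: order_tendstoD(2))
  moreover have "\<forall>\<^sub>F z in at z0 within orthant. z \<in> orthant"
    by (simp add: eventually_at_filter)
  ultimately show ?thesis
  proof eventually_elim
    case (elim z)
    obtain s where "expenditure v pr (v z) = pr \<bullet> s" "pr \<bullet> s \<le> pr \<bullet> t1"
      using expenditure_attained[OF cont pr elim(2)] t1(1) elim(1) by (metis less_imp_le)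
    with cost t(3) show ?case by simp
  qed
qed

section \<open>Semicontinuity of the total cost and compactness of the feasible set\<close>

lemma S_cost_eq_expenditure:
  "S_cost u p q = (\<Sum>j\<in>UNIV. expenditure (u j) (p j) (u j (column j q)))"
  by (simp add: S_cost_def expenditure_def)

lemma continuous_column [continuous_intros]:
  "continuous_on A (\<lambda>q :: real^'l^'k. column j q)"
  unfolding column_def by (intro continuous_intros)

lemma column_prob_matrices: "q \<in> prob_matrices \<Longrightarrow> column j q \<in> orthant"
  by (simp add: prob_matrices_def orthant_def column_def)

lemma S_cost_usc:
  fixes q0 :: "real^'l^'k"
  assumes cont: "\<And>j. continuous_on orthant (u j)" and incr: "\<And>j. increasing_utility (u j)"
    and p: "\<And>j i. 0 < p j $ i" and q0: "q0 \<in> prob_matrices" and c: "S_cost u p q0 < c"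
  shows "\<forall>\<^sub>F q in at q0 within prob_matrices. S_cost u p q < c"
proof -
  let ?E = "\<lambda>j q. expenditure (u j) (p j) (u j (column j q))"
  \<comment> \<open>The slack below \<open>c\<close> is shared equally among the consumers.\<close>
  define \<epsilon> where "\<epsilon> = (c - S_cost u p q0) / real CARD('l)"
  have eps: "0 < \<epsilon>" using c by (simp add: \<epsilon>_def)
  have "\<forall>\<^sub>F q in at q0 within prob_matrices. ?E j q < ?E j q0 + \<epsilon>" for j
  proof -
    have "\<forall>\<^sub>F z in at (column j q0) within orthant.
        expenditure (u j) (p j) (u j z) < ?E j q0 + \<epsilon>"
      by (rule expenditure_usc[OF cont incr p column_prob_matrices[OF q0] eps])
    then obtain T where T: "open T" "column j q0 \<in> T"
      "\<And>z. z \<in> T \<Longrightarrow> z \<in> orthant \<Longrightarrow> z \<noteq> column j q0 \<Longrightarrow>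
        expenditure (u j) (p j) (u j z) < ?E j q0 + \<epsilon>"
      unfolding eventually_at_topological by blast
    have "open ((\<lambda>q. column j q) -` T)"
      by (intro open_vimage T continuous_intros)
    \<comment> \<open>The filter at \<open>column j q0\<close> omits that column, but matrices other
      than \<open>q0\<close> may share it; there the two costs agree and \<open>\<epsilon>\<close>
      is positive.\<close>
    moreover have "?E j q < ?E j q0 + \<epsilon>" if "column j q \<in> T" "q \<in> prob_matrices" for q
      using T(3)[OF that(1) column_prob_matrices[OF that(2)]] eps by (cases "column j q = column j q0") auto
    ultimately show ?thesis
      unfolding eventually_at_topological using T(2)
      by (intro exI[of _ "(\<lambda>q. column j q) -` T"]) auto
  qed
  then have "\<forall>\<^sub>F q in at q0 within prob_matrices. \<forall>j. ?E j q < ?E j q0 + \<epsilon>"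
    by (rule eventually_all_finite)
  then show ?thesis
  proof eventually_elim
    case (elim q)
    have "S_cost u p q < (\<Sum>j\<in>UNIV. ?E j q0 + \<epsilon>)"
      unfolding S_cost_eq_expenditure using elim by (intro sum_strict_mono) auto
    also have "\<dots> = c"
      by (simp add: sum.distrib S_cost_eq_expenditure[symmetric] \<epsilon>_def)
    finally show ?case .
  qed
qed

lemma compact_prob_matrices: "compact (prob_matrices :: (real^'l^'k) set)"
proof -
  have "norm (q :: real^'l^'k) \<le> 1" if "q \<in> prob_matrices" for q
  proof -
    have "norm q \<le> (\<Sum>i\<in>UNIV. norm (q $ i))" 
      unfolding norm_vec_def by (rule L2_set_le_sum) simp
    also have "\<dots> \<le> (\<Sum>i\<in>UNIV. \<Sum>j\<in>UNIV. \<bar>q $ i $ j\<bar>)"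
      by (intro sum_mono norm_le_l1_cart)
    also have "\<dots> = 1" using that by (simp add: prob_matrices_def)
    finally show ?thesis .
  qed
  then have "bounded (prob_matrices :: (real^'l^'k) set)"
    by (auto simp: bounded_iff)
  moreover have "(prob_matrices :: (real^'l^'k) set)
      = (\<Inter>i. \<Inter>j. {q. 0 \<le> q $ i $ j}) \<inter> {q. (\<Sum>i\<in>UNIV. \<Sum>j\<in>UNIV. q $ i $ j) = 1}"
    by (auto simp: prob_matrices_def)
  moreover have "closed \<dots>"
    by (intro closed_Int closed_INT ballI closed_Collect_le closed_Collect_eq continuous_intros)
  ultimately show ?thesis by (simp add: compact_eq_bounded_closed)
qed

lemma closed_compatible: "closed {q :: real^'l^'k. compatible x y G q}"
proof -
  have "{q :: real^'l^'k. compatible x y G q}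
      = (\<Inter>i. \<Inter>j. if curves G (x i) (y j) = {} then {q. q $ i $ j = 0} else UNIV)
        \<inter> (\<Inter>e\<in>parcs (net G).
            {q. (\<Sum>(i, j) \<in> {(i, j). \<exists>c\<in>curves G (x i) (y j). e \<in> set (vwalk_arcs c)}. q $ i $ j)
              = weight G e})"
    by (auto simp: compatible_def split: if_splits)
  also have "closed \<dots>"
    by (auto intro!: closed_Int closed_INT closed_Collect_eq continuous_intros
        simp: case_prod_unfold)
  finally show ?thesis .
qed

lemma compact_feasible:
  fixes qbar :: "real^'l^'k"
  assumes cont: "\<And>j. continuous_on orthant (u j)"
  shows "compact (feasible u x y qbar G)"
proof -
  have "continuous_on prob_matrices (\<lambda>q. u j (column j q))" for j
    by (rule continuous_on_compose2[OF cont]) (auto intro: continuous_intros column_prob_matrices)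
  then have "closed (prob_matrices \<inter> (\<lambda>q. u j (column j q)) -` {u j (column j qbar)..})" for j
    by (intro continuous_closed_preimage compact_imp_closed[OF compact_prob_matrices] closed_atLeast)
  then have "compact (prob_matrices \<inter> ({q. compatible x y G q} \<inter>
      (\<Inter>j. prob_matrices \<inter> (\<lambda>q. u j (column j q)) -` {u j (column j qbar)..})))"
    by (intro compact_Int_closed compact_prob_matrices closed_Int closed_compatible closed_INT) auto
  then show ?thesis
    by (rule back_subst[of compact]) (auto simp: feasible_def)
qed

text \<open>A maximizer is what gives \<open>GREATEST\<close> its intended value; compactness and
  upper semicontinuity supply it.\<close>

lemma exchange_value_attained:
  fixes qbar :: "real^'l^'k"
  assumes cont: "\<And>j. continuous_on orthant (u j)" and incr: "\<And>j. increasing_utility (u j)"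
    and p: "\<And>j i. 0 < p j $ i" and ne: "feasible u x y qbar G \<noteq> {}"
  obtains q where "q \<in> feasible u x y qbar G"
    "exchange_value u p x y qbar G = S_cost u p q - S_cost u p qbar"
    "\<And>r. r \<in> feasible u x y qbar G \<Longrightarrow> S_cost u p r \<le> S_cost u p q"
proof -
  have sub: "feasible u x y qbar G \<subseteq> prob_matrices" by (auto simp: feasible_def)
  have "\<forall>\<^sub>F q in at q0 within feasible u x y qbar G. S_cost u p q < c"
    if "q0 \<in> feasible u x y qbar G" "S_cost u p q0 < c" for q0 c
    \<comment> \<open>Semicontinuity passes to the feasible set because restricting to a subset
      gives a finer filter.\<close>
    using filter_leD[OF at_le[OF sub] S_cost_usc[where u = u and p = p, OF cont incr p]] that sub by blast
  then obtain q where q: "q \<in> feasible u x y qbar G"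
    "\<And>r. r \<in> feasible u x y qbar G \<Longrightarrow> S_cost u p r \<le> S_cost u p q"
    using usc_attains_sup[OF compact_feasible[of u, OF cont] ne, of "S_cost u p"] by metis
  have "(GREATEST s. \<exists>q\<in>feasible u x y qbar G. s = S_cost u p q) = S_cost u p q"
    by (rule Greatest_equality) (use q in auto)
  with q that show ?thesis by (simp add: exchange_value_def)
qed

section \<open>Comparison of the two feasible sets\<close>

lemma feasible_subset_hub_path:
  fixes qbar :: "real^'l^'k"
  assumes xy: "inj x" "inj y" "range x \<inter> range y = {}" and xs: "xs \<notin> range x \<union> range y"
    and G: "G \<in> Omega X x y qbar"
  shows "feasible u x y qbar G
    \<subseteq> feasible u x y qbar (hub_path x y (total_supply qbar) (total_demand qbar) xs)"
proof
  fix q assume q: "q \<in> feasible u x y qbar G"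
  interpret pair_fin_digraph "net G"
    using G by (simp add: Omega_def transport_path_def)
  have uniq: "\<forall>i j. \<forall>c\<in>curves G (x i) (y j). \<forall>c'\<in>curves G (x i) (y j). c = c'"
    using G by (simp add: Omega_def transport_path_def)
  have "compatible x y G q" "compatible x y G qbar"
    using q G by (auto simp: feasible_def Omega_def)
  note marginals = compatible_same_marginals[OF pair_finite_arcs uniq xy this]
  then show "q \<in> feasible u x y qbar (hub_path x y (total_supply qbar) (total_demand qbar) xs)"
    \<comment> \<open>Since \<open>q\<close> and \<open>qbar\<close> share their marginals, the hub
      path weighted by \<open>q\<close> is the one weighted by \<open>qbar\<close>; the utility
      constraints do not involve the path.\<close>
    using compatible_hub_path[OF xy xs, of q] q by (simp add: feasible_def marginals)
qed

theorem proposition3p1: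
  fixes X :: "(real^'m) set"
    and x :: "'k::finite \<Rightarrow> real^'m"
    and y :: "'l::finite \<Rightarrow> real^'m"
    and u :: "'l \<Rightarrow> real^'k \<Rightarrow> real"
    and w :: "'l \<Rightarrow> real"
    and p :: "'l \<Rightarrow> real^'k"
    and qbar :: "real^'l^'k"
    and xstar :: "real^'m"
    and G :: "(real^'m) weighted_net"
  assumes "compact X" and "convex X"
    and "range x \<subseteq> X" and "range y \<subseteq> X"
    and "inj x" and "inj y" and "range x \<inter> range y = {}"
    and "\<And>j. continuous_on orthant (u j)"
    and "\<And>j. concave_on orthant (u j)"
    and "\<And>j. increasing_utility (u j)"
    and "\<And>j. 0 < w j"
    and "\<And>j i. 0 < p j $ i"
    and "\<And>j. is_arg_max (u j) (\<lambda>t. t \<in> budget_set (p j) (w j)) (column j qbar)"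
    and "(\<Sum>i\<in>UNIV. \<Sum>j\<in>UNIV. qbar $ i $ j) = 1"
    and "\<And>i. 0 < total_supply qbar i" and "\<And>j. 0 < total_demand qbar j"
    and "xstar \<in> X - (range x \<union> range y)"
    and "G \<in> Omega X x y qbar"
  shows "0 \<le> exchange_value u p x y qbar G
    \<and> exchange_value u p x y qbar G
        \<le> exchange_value u p x y qbar (hub_path x y (total_supply qbar) (total_demand qbar) xstar)"
proof -
  let ?H = "hub_path x y (total_supply qbar) (total_demand qbar) xstar"
  note cont = assms(8) and incr = assms(10) and pos = assms(12)
  \<comment> \<open>Nonnegativity comes from each column lying in its budget set.\<close>
  have "0 \<le> qbar $ i $ j" for i j
    using assms(13)[of j] by (simp add: is_arg_max_def budget_set_def orthant_def column_def)
  then have qbar: "qbar \<in> feasible u x y qbar G"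
    using assms(14) \<open>G \<in> Omega X x y qbar\<close> by (simp add: feasible_def prob_matrices_def Omega_def)
  have sub: "feasible u x y qbar G \<subseteq> feasible u x y qbar ?H"
    using assms(17,18) by (intro feasible_subset_hub_path assms(5-7)) auto
  obtain q where q: "q \<in> feasible u x y qbar G"
    "exchange_value u p x y qbar G = S_cost u p q - S_cost u p qbar"
    "\<And>r. r \<in> feasible u x y qbar G \<Longrightarrow> S_cost u p r \<le> S_cost u p q"
    using exchange_value_attained[of u p x y qbar G, OF cont incr pos] qbar by blast
  obtain r where r: "exchange_value u p x y qbar ?H = S_cost u p r - S_cost u p qbar"
    "\<And>q. q \<in> feasible u x y qbar ?H \<Longrightarrow> S_cost u p q \<le> S_cost u p r"
    using exchange_value_attained[of u p x y qbar ?H, OF cont incr pos] qbar sub by blast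
  show ?thesis
    \<comment> \<open>\<open>qbar\<close> competes in the maximum for \<open>G\<close>, and the
      maximizer \<open>q\<close> for \<open>G\<close> competes in the maximum for the hub.\<close>
    using q(2) q(3)[OF qbar] r(1) r(2)[of q] q(1) sub by auto
qed

end
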